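(* For every $i\in\mathcal{V}$ and $j\in\mathcal{I}(i)\setminus\{i\}$, let $\ell_j^i$ be defined by $$\ell_j^i=\begin{cases}1&\text{if }\Psi_i(U_i^{L,n+1}+P_{ij}^n)\ge0,\\ \max\{\ell\in[0,1]:\Psi_i(U_i^{L,n+1}+\ell P_{ij}^n)\ge0\}&\text{otherwise.}\end{cases}$$ The following two statements hold true: (i) $\Psi_i(U_i^{L,n+1}+\ell P_{ij}^n)\ge0$ for every $\ell\in[0,\ell_j^i]$; (ii) setting $\ell_{ij}:=\min(\ell_j^i,\ell_i^j)$, we have $\Psi_i(U_i^{L,n+1}+\ell_{ij}P_{ij}^n)\ge0$ and $\ell_{ij}=\ell_{ji}$.
   Context: $\mathcal{V}$ is a finite index set; for each $i\in\mathcal{V}$, $\mathcal{I}(i)\subset\mathcal{V}$ contains $i$, and $j\in\mathcal{I}(i)$ iff $i\in\mathcal{I}(j)$. $\mathcal{B}\subset\mathbb{R}^m$ is a convex set and, for each $i\in\mathcal{V}$, $\Psi_i:\mathcal{B}\to\mathbb{R}$ is quasiconcave, i.e. $\{U\in\mathcal{B}:\Psi_i(U)\ge\chi\}$ is convex for every $\chi\in\mathbb{R}$. The vectors $U_i^{L,n+1}\in\mathcal{B}$ (low-order updates) satisfy $\Psi_i(U_i^{L,n+1})\ge0$ for each $i\in\mathcal{V}$. The vectors $P_{ij}^n\in\mathbb{R}^m$, $j\in\mathcal{I}(i)\setminus\{i\}$, are given by $P_{ij}^n=\frac{1}{m_i\lambda_j}A_{ij}^n$, where $m_i>0$, $\lambda_j>0$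 with $\sum_{j\in\mathcal{I}(i)\setminus\{i\}}\lambda_j=1$ (the $\lambda_j$ may depend on $i$), and $A_{ij}^n=-A_{ji}^n\in\mathbb{R}^m$. An inequality $\Psi_i(V)\ge0$ means $V\in\mathcal{B}$ and $\Psi_i(V)\ge0$; the maximum in the definition of $\ell_j^i$ is assumed to be attained. *)

theory Defs
  imports "HOL-Analysis.Analysis"
begin

definition quasiconcave_on :: "'a::real_vector set \<Rightarrow> ('a \<Rightarrow> real) \<Rightarrow> bool" where
  "quasiconcave_on B \<psi> \<longleftrightarrow> (\<forall>c. convex {U \<in> B. \<psi> U \<ge> c})"

text \<open>A function from \<open>B\<close> to the reals is represented by a total function whose values outside
  \<open>B\<close> are irrelevant; hence the inequality \<open>\<psi>(W) \<ge> 0\<close> includes \<open>W \<in> B\<close>.\<close>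

definition admissible :: "'a set \<Rightarrow> ('a \<Rightarrow> real) \<Rightarrow> 'a \<Rightarrow> bool" where
  "admissible B \<psi> W \<longleftrightarrow> W \<in> B \<and> \<psi> W \<ge> 0"

definition admissible_steps ::
  "'a::real_vector set \<Rightarrow> ('a \<Rightarrow> real) \<Rightarrow> 'a \<Rightarrow> 'a \<Rightarrow> real set" where
  "admissible_steps B \<psi> U P = {l \<in> {0..1}. admissible B \<psi> (U + l *\<^sub>R P)}"

definition has_maximum :: "real set \<Rightarrow> bool" where
  "has_maximum S \<longleftrightarrow> (\<exists>l\<in>S. \<forall>k\<in>S. k \<le> l)"

text \<open>The set of admissible steps is infinite in general, so its maximum is not \<open>Max\<close>.
  The value of \<open>GREATEST\<close> is the maximum when the maximum is attained, and unspecified otherwise.\<close>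

definition limiter ::
  "'a::real_vector set \<Rightarrow> ('a \<Rightarrow> real) \<Rightarrow> 'a \<Rightarrow> 'a \<Rightarrow> real" where
  "limiter B \<psi> U P =
     (if admissible B \<psi> (U + P) then 1
      else (GREATEST l. l \<in> admissible_steps B \<psi> U P))"

text \<open>The number \<open>l\<^sub>j\<^sup>i\<close> is \<open>limiter B (\<Psi> i) (U i) (P i j)\<close>; the number
  \<open>l\<^sub>i\<^sub>j = min (l\<^sub>j\<^sup>i) (l\<^sub>i\<^sup>j)\<close> is the following.\<close>

definition sym_limiter ::
  "'a::real_vector set \<Rightarrow> ('v \<Rightarrow> 'a \<Rightarrow> real) \<Rightarrow> ('v \<Rightarrow> 'a) \<Rightarrow> ('v \<Rightarrow> 'v \<Rightarrow> 'a)
    \<Rightarrow> 'v \<Rightarrow> 'v \<Rightarrow> real" where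
  "sym_limiter B \<Psi> U P i j =
     min (limiter B (\<Psi> i) (U i) (P i j)) (limiter B (\<Psi> j) (U j) (P j i))"

end

theory Submission
  imports Defs
begin

text \<open>
  The superlevel set \<open>{W \<in> B. \<psi> W \<ge> 0}\<close> is convex by quasiconcavity, and a line meets a convex
  set in an interval. So the steps \<open>l\<close> for which \<open>U + l P\<close> is admissible fill out an interval: once
  \<open>0\<close> and \<open>l\<close> belong to it, so does everything in between. The low-order update puts
  \<open>0\<close> in it, and the limiter is itself an admissible step, either \<open>1\<close> or an attained maximum
  (\<open>limiter_in_admissible_steps\<close>). Hence every step up to the limiter is admissible, which is (i).

  For (ii), the symmetrized limiter lies between \<open>0\<close> and the one-sided limiter of \<open>i\<close>, so (i)
  applies to it. The lower bound is where symmetry of the stencil enters: the opposite limiter is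
  known to be nonnegative because \<open>i\<close> is in turn a neighbour of \<open>j\<close>, so that the hypothesis of an
  attained maximum is available for the pair \<open>(j, i)\<close> too. The equality \<open>l\<^sub>i\<^sub>j = l\<^sub>j\<^sub>i\<close> is
  commutativity of the minimum.
\<close>

lemma admissible_shorter_step:
  assumes "quasiconcave_on B \<psi>" "admissible B \<psi> U" "admissible B \<psi> (U + k *\<^sub>R P)"
    and l: "0 \<le> l" "l \<le> k"
  shows "admissible B \<psi> (U + l *\<^sub>R P)"
proof (cases "k = 0")
  case True
  then show ?thesis using assms by simp
next
  case False
  define t where "t = l / k"
  have t: "0 \<le> t" "t \<le> 1" "t * k = l"
    using False l by (simp_all add: t_def)
  have "convex {W. admissible B \<psi> W}"
    using assms(1) by (simp add: quasiconcave_on_def admissible_def)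
  then have "(1 - t) *\<^sub>R U + t *\<^sub>R (U + k *\<^sub>R P) \<in> {W. admissible B \<psi> W}"
    using assms(2,3) t by (intro convexD_alt) auto
  also have "(1 - t) *\<^sub>R U + t *\<^sub>R (U + k *\<^sub>R P) = U + l *\<^sub>R P"
    using t(3) by (simp add: algebra_simps)
  finally show ?thesis by simp
qed

text \<open>
  The description by \<open>GREATEST\<close> says nothing unless a greatest step exists, so the attained
  maximum is what turns the second branch of the limiter into an actual admissible step.
\<close>

lemma limiter_in_admissible_steps:
  assumes "\<not> admissible B \<psi> (U + P) \<Longrightarrow> has_maximum (admissible_steps B \<psi> U P)"
  shows "limiter B \<psi> U P \<in> admissible_steps B \<psi> U P"
proof (cases "admissible B \<psi> (U + P)")
  case True
  then show ?thesis by (simp add: limiter_def admissible_steps_def)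
next
  case False
  with assms obtain l where "l \<in> admissible_steps B \<psi> U P"
    and "\<And>k. k \<in> admissible_steps B \<psi> U P \<Longrightarrow> k \<le> l"
    by (auto simp: has_maximum_def)
  then have "(GREATEST l. l \<in> admissible_steps B \<psi> U P) \<in> admissible_steps B \<psi> U P"
    by (rule GreatestI2_order)
  with False show ?thesis by (simp add: limiter_def)
qed

lemma admissible_upto_limiter:
  assumes "quasiconcave_on B \<psi>" "admissible B \<psi> U"
    and "\<not> admissible B \<psi> (U + P) \<Longrightarrow> has_maximum (admissible_steps B \<psi> U P)"
    and "0 \<le> l" "l \<le> limiter B \<psi> U P"
  shows "admissible B \<psi> (U + l *\<^sub>R P)"
  using admissible_shorter_step[OF assms(1,2) _ assms(4,5)]
    limiter_in_admissible_steps[OF assms(3)]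
  by (simp add: admissible_steps_def)

lemma sym_limiter_commute: "sym_limiter B \<Psi> U P i j = sym_limiter B \<Psi> U P j i"
  by (simp add: sym_limiter_def min.commute)

theorem theorem7p21:
  fixes \<V> :: "'v set"
    and \<I> :: "'v \<Rightarrow> 'v set"
    and B :: "(real ^ 'm) set"
    and \<Psi> :: "'v \<Rightarrow> real ^ 'm \<Rightarrow> real"
    and U :: "'v \<Rightarrow> real ^ 'm"
    and P A :: "'v \<Rightarrow> 'v \<Rightarrow> real ^ 'm"
    and mass :: "'v \<Rightarrow> real"
    and lam :: "'v \<Rightarrow> 'v \<Rightarrow> real"
  assumes finite_V: "finite \<V>"
    and I_subset: "\<And>i. i \<in> \<V> \<Longrightarrow> \<I> i \<subseteq> \<V>"
    and I_self: "\<And>i. i \<in> \<V> \<Longrightarrow> i \<in> \<I> i"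
    and I_sym: "\<And>i j. i \<in> \<V> \<Longrightarrow> j \<in> \<V> \<Longrightarrow> j \<in> \<I> i \<longleftrightarrow> i \<in> \<I> j"
    and convex_B: "convex B"
    and quasiconcave: "\<And>i. i \<in> \<V> \<Longrightarrow> quasiconcave_on B (\<Psi> i)"
    and low_order: "\<And>i. i \<in> \<V> \<Longrightarrow> admissible B (\<Psi> i) (U i)"
    and mass_pos: "\<And>i. i \<in> \<V> \<Longrightarrow> mass i > 0"
    and lam_pos: "\<And>i j. i \<in> \<V> \<Longrightarrow> j \<in> \<I> i - {i} \<Longrightarrow> lam i j > 0"
    and lam_sum: "\<And>i. i \<in> \<V> \<Longrightarrow> (\<Sum>j\<in>\<I> i - {i}. lam i j) = 1"
    and A_skew: "\<And>i j. i \<in> \<V> \<Longrightarrow> j \<in> \<I> i - {i} \<Longrightarrow> A i j = - A j i"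
    and P_eq: "\<And>i j. i \<in> \<V> \<Longrightarrow> j \<in> \<I> i - {i} \<Longrightarrow>
                 P i j = (1 / (mass i * lam i j)) *\<^sub>R A i j"
    and max_attained: "\<And>i j. i \<in> \<V> \<Longrightarrow> j \<in> \<I> i - {i} \<Longrightarrow>
                 \<not> admissible B (\<Psi> i) (U i + P i j) \<Longrightarrow>
                 has_maximum (admissible_steps B (\<Psi> i) (U i) (P i j))"
  shows "(\<forall>i\<in>\<V>. \<forall>j\<in>\<I> i - {i}. \<forall>l\<in>{0..limiter B (\<Psi> i) (U i) (P i j)}.
            admissible B (\<Psi> i) (U i + l *\<^sub>R P i j)) \<and>
         (\<forall>i\<in>\<V>. \<forall>j\<in>\<I> i - {i}.
            admissible B (\<Psi> i) (U i + sym_limiter B \<Psi> U P i j *\<^sub>R P i j) \<and>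
            sym_limiter B \<Psi> U P i j = sym_limiter B \<Psi> U P j i)"
proof (intro conjI ballI)
  fix i j l
  assume "i \<in> \<V>" "j \<in> \<I> i - {i}" "l \<in> {0..limiter B (\<Psi> i) (U i) (P i j)}"
  then show "admissible B (\<Psi> i) (U i + l *\<^sub>R P i j)"
    using quasiconcave low_order max_attained by (intro admissible_upto_limiter) auto
next
  fix i j
  assume i: "i \<in> \<V>" and j: "j \<in> \<I> i - {i}"
  then have j': "j \<in> \<V>" and i': "i \<in> \<I> j - {j}"
    using I_subset I_sym by blast+
  have "limiter B (\<Psi> i) (U i) (P i j) \<in> admissible_steps B (\<Psi> i) (U i) (P i j)"
    using max_attained[OF i j] by (rule limiter_in_admissible_steps)
  moreover have "limiter B (\<Psi> j) (U j) (P j i) \<in> admissible_steps B (\<Psi> j) (U j) (P j i)"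
    using max_attained[OF j' i'] by (rule limiter_in_admissible_steps)
  ultimately have "0 \<le> sym_limiter B \<Psi> U P i j"
    by (simp add: sym_limiter_def admissible_steps_def)
  then show "admissible B (\<Psi> i) (U i + sym_limiter B \<Psi> U P i j *\<^sub>R P i j)"
    using quasiconcave[OF i] low_order[OF i] max_attained[OF i j]
    by (intro admissible_upto_limiter) (auto simp: sym_limiter_def)
next
  fix i j
  show "sym_limiter B \<Psi> U P i j = sym_limiter B \<Psi> U P j i"
    by (rule sym_limiter_commute)
qed

end
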